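(* Let $\{(X_n,d_n)\}_n$ be a sequence of bounded Lorentzian length spaces containing $i^0$ which converges in the Gromov-Hausdorff sense to a bounded Lorentzian-metric space $(X,d)$ containing $i^0$, i.e. $d_{GH}(X_n,X)\to0$. Then $(X,d)$ is a bounded Lorentzian length space. The same statement holds with "length space" replaced by "prelength space" throughout: if all $(X_n,d_n)$ are bounded Lorentzian prelength spaces containing $i^0$, then so is $(X,d)$.
   Context: A bounded Lorentzian-metric space $(X,d)$ is a set $X$ with a map $d\colon X\times X\to[0,\infty)$ such that: (i) if $d(x,y)>0$ and $d(y,z)>0$ then $d(x,z)\ge d(x,y)+d(y,z)$; (ii) there is a topology $T$ on $X$ such that $d$ is continuous for $T\times T$ and for every $\epsilon>0$ the set $\{(p,q): d(p,q)\ge\epsilon\}$ is compact for $T\times T$; (iii) for every $x\ne y$ there is $z$ with $d(x,z)\ne d(y,z)$ or $d(z,x)\ne d(z,y)$. The topology $\mathscr{T}$ of $(X,d)$ is the intersection of all topologies $T$ as in (ii); topological notions on $X$ refer to $\mathscr{T}$. The space contains $i^0$ if there is a (necessarily unique) point $i^0\in X$ with $d(i^0,p)=d(p,i^0)=0$ for all $p\in X$. Write $x\ll y$ if $d(x,y)>0$. The (extended) causal relation is $J=\{(x,y)\in X\times X:\ \forall p\in X,\ d(p,y)\ge d(p,x)\text{ and } d(x,p)\ge d(y,p)\}$; write $x\le y$ for $(x,y)\in J$ and $x<y$ if $x\le y$ and $x\neq y$. A continuous curve $\sigma\colon[a,b]\to X$ is isocausal if $\sigma(t)<\sigma(t')$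 whenever $t<t'$. An isocausal curve is maximal if $d(\sigma(t),\sigma(t'))+d(\sigma(t'),\sigma(t''))=d(\sigma(t),\sigma(t''))$ for all $t<t'<t''$ in $[a,b]$. $(X,d)$ is a bounded Lorentzian prelength space if for all $x\ll y$ there is an isocausal curve from $x$ to $y$; it is a bounded Lorentzian length space if for all $x\ll y$ there is a maximal isocausal curve from $x$ to $y$. A correspondence between nonempty sets $X$ and $Y$ is a relation $R\subset X\times Y$ such that every $x\in X$ is related to some $y\in Y$ and vice versa. Its distortion is $\mathrm{dis}\,R=\sup\{|d_X(x,x')-d_Y(y,y')| : (x,y),(x',y')\in R\}$, and $d_{GH}(X,Y)=\inf_R \mathrm{dis}\,R$ over all correspondences. *)

theory Defs
  imports "HOL-Analysis.Analysis"
begin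

text \<open>
  As for \<^locale>\<open>Metric_space\<close>, a space is a carrier set \<open>X\<close> together with a function \<open>d\<close> on the
  ambient type, of which only the values on the carrier matter.
\<close>

definition lorentzian_admissible ::
    "'a set \<Rightarrow> ('a \<Rightarrow> 'a \<Rightarrow> real) \<Rightarrow> 'a topology \<Rightarrow> bool" where
  "lorentzian_admissible X d T \<longleftrightarrow>
     topspace T = X \<and>
     continuous_map (prod_topology T T) euclideanreal (\<lambda>(p, q). d p q) \<and>
     (\<forall>\<epsilon>>0. compactin (prod_topology T T) {(p, q). p \<in> X \<and> q \<in> X \<and> d p q \<ge> \<epsilon>})"

definition bounded_lorentzian_metric_space ::
    "'a set \<Rightarrow> ('a \<Rightarrow> 'a \<Rightarrow> real) \<Rightarrow> bool" where
  "bounded_lorentzian_metric_space X d \<longleftrightarrow>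
     (\<forall>x\<in>X. \<forall>y\<in>X. d x y \<ge> 0) \<and>
     (\<forall>x\<in>X. \<forall>y\<in>X. \<forall>z\<in>X. d x y > 0 \<and> d y z > 0 \<longrightarrow> d x z \<ge> d x y + d y z) \<and>
     (\<exists>T. lorentzian_admissible X d T) \<and>
     (\<forall>x\<in>X. \<forall>y\<in>X. x \<noteq> y \<longrightarrow> (\<exists>z\<in>X. d x z \<noteq> d y z \<or> d z x \<noteq> d z y))"

text \<open>
  The intersection of all admissible topologies. The conjunct \<open>U \<subseteq> X\<close> is redundant as soon as
  there is an admissible topology.
\<close>

definition lorentzian_topology :: "'a set \<Rightarrow> ('a \<Rightarrow> 'a \<Rightarrow> real) \<Rightarrow> 'a topology" where
  "lorentzian_topology X d =
     topology (\<lambda>U. U \<subseteq> X \<and> (\<forall>T. lorentzian_admissible X d T \<longrightarrow> openin T U))"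

lemma openin_lorentzian_topology:
  "openin (lorentzian_topology X d) U \<longleftrightarrow>
     U \<subseteq> X \<and> (\<forall>T. lorentzian_admissible X d T \<longrightarrow> openin T U)"
proof -
  have "istopology (\<lambda>U. U \<subseteq> X \<and> (\<forall>T. lorentzian_admissible X d T \<longrightarrow> openin T U))"
    unfolding istopology_def by blast
  then show ?thesis
    by (simp add: lorentzian_topology_def)
qed

lemma topspace_lorentzian_topology [simp]: "topspace (lorentzian_topology X d) = X"
proof -
  have "openin (lorentzian_topology X d) X"
    unfolding openin_lorentzian_topology lorentzian_admissible_def by auto
  then show ?thesis
    unfolding topspace_def by (auto simp: openin_lorentzian_topology)
qed

definition contains_i0 :: "'a set \<Rightarrow> ('a \<Rightarrow> 'a \<Rightarrow> real) \<Rightarrow> bool" where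
  "contains_i0 X d \<longleftrightarrow> (\<exists>i0\<in>X. \<forall>p\<in>X. d i0 p = 0 \<and> d p i0 = 0)"

definition causal_relation :: "'a set \<Rightarrow> ('a \<Rightarrow> 'a \<Rightarrow> real) \<Rightarrow> ('a \<times> 'a) set" where
  "causal_relation X d =
     {(x, y). x \<in> X \<and> y \<in> X \<and> (\<forall>p\<in>X. d p y \<ge> d p x \<and> d x p \<ge> d y p)}"

definition isocausal_curve ::
    "'a set \<Rightarrow> ('a \<Rightarrow> 'a \<Rightarrow> real) \<Rightarrow> real \<Rightarrow> real \<Rightarrow> (real \<Rightarrow> 'a) \<Rightarrow> bool" where
  "isocausal_curve X d a b \<sigma> \<longleftrightarrow>
     a < b \<and>
     continuous_map (top_of_set {a..b}) (lorentzian_topology X d) \<sigma> \<and>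
     (\<forall>t\<in>{a..b}. \<forall>t'\<in>{a..b}.
        t < t' \<longrightarrow> (\<sigma> t, \<sigma> t') \<in> causal_relation X d \<and> \<sigma> t \<noteq> \<sigma> t')"

definition maximal_isocausal_curve ::
    "'a set \<Rightarrow> ('a \<Rightarrow> 'a \<Rightarrow> real) \<Rightarrow> real \<Rightarrow> real \<Rightarrow> (real \<Rightarrow> 'a) \<Rightarrow> bool" where
  "maximal_isocausal_curve X d a b \<sigma> \<longleftrightarrow>
     isocausal_curve X d a b \<sigma> \<and>
     (\<forall>t\<in>{a..b}. \<forall>t'\<in>{a..b}. \<forall>t''\<in>{a..b}.
        t < t' \<and> t' < t'' \<longrightarrow> d (\<sigma> t) (\<sigma> t') + d (\<sigma> t') (\<sigma> t'') = d (\<sigma> t) (\<sigma> t''))"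

definition bounded_lorentzian_prelength_space ::
    "'a set \<Rightarrow> ('a \<Rightarrow> 'a \<Rightarrow> real) \<Rightarrow> bool" where
  "bounded_lorentzian_prelength_space X d \<longleftrightarrow>
     bounded_lorentzian_metric_space X d \<and>
     (\<forall>x\<in>X. \<forall>y\<in>X. d x y > 0 \<longrightarrow>
        (\<exists>a b \<sigma>. isocausal_curve X d a b \<sigma> \<and> \<sigma> a = x \<and> \<sigma> b = y))"

definition bounded_lorentzian_length_space ::
    "'a set \<Rightarrow> ('a \<Rightarrow> 'a \<Rightarrow> real) \<Rightarrow> bool" where
  "bounded_lorentzian_length_space X d \<longleftrightarrow>
     bounded_lorentzian_metric_space X d \<and>
     (\<forall>x\<in>X. \<forall>y\<in>X. d x y > 0 \<longrightarrow>
        (\<exists>a b \<sigma>. maximal_isocausal_curve X d a b \<sigma> \<and> \<sigma> a = x \<and> \<sigma> b = y))"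

definition correspondence :: "'a set \<Rightarrow> 'b set \<Rightarrow> ('a \<times> 'b) set \<Rightarrow> bool" where
  "correspondence X Y R \<longleftrightarrow>
     R \<subseteq> X \<times> Y \<and> (\<forall>x\<in>X. \<exists>y\<in>Y. (x, y) \<in> R) \<and> (\<forall>y\<in>Y. \<exists>x\<in>X. (x, y) \<in> R)"

text \<open>
  The supremum and the infimum are taken in \<^typ>\<open>ennreal\<close>, so that an unbounded set of
  differences has distortion \<open>\<infinity>\<close> rather than an unspecified real value.
\<close>

definition distortion ::
    "('a \<Rightarrow> 'a \<Rightarrow> real) \<Rightarrow> ('b \<Rightarrow> 'b \<Rightarrow> real) \<Rightarrow> ('a \<times> 'b) set \<Rightarrow> ennreal" where
  "distortion dX dY R =
     Sup {ennreal \<bar>dX x x' - dY y y'\<bar> | x x' y y'. (x, y) \<in> R \<and> (x', y') \<in> R}"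

definition gromov_hausdorff_dist ::
    "'a set \<Rightarrow> ('a \<Rightarrow> 'a \<Rightarrow> real) \<Rightarrow> 'b set \<Rightarrow> ('b \<Rightarrow> 'b \<Rightarrow> real) \<Rightarrow> ennreal" where
  "gromov_hausdorff_dist X dX Y dY = Inf {distortion dX dY R | R. correspondence X Y R}"

end

theory Submission
  imports Defs
begin

text \<open>
  The idea of the proof is to turn causal curves into objects that a point-by-point limit respects.
  Three ingredients make this work.

  First, the topology of a bounded Lorentzian-metric space is that of a metric, the distinction metric
  \<open>sup\<^sub>z max (\<bar>d x z - d y z\<bar>, \<bar>d z x - d z y\<bar>)\<close> (\<open>lorentzian_topology_eq\<close>): it is admissible, and
  every admissible topology is finer, by a tube-lemma argument over the compact set \<open>d \<ge> e\<close>. The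
  function \<open>d\<close> is Lipschitz for it. If the space contains \<open>i\<^sup>0\<close>, then whatever lies outside
  the projections of \<open>{d \<ge> e}\<close> is close to \<open>i\<^sup>0\<close>, so the space is compact
  (\<open>compact_space_mtopology\<close>).

  Second, for a dense sequence \<open>p\<close> of the limit space \<open>X\<close>, the function
  \<open>\<tau> x = (\<Sum>k. 2\<^sup>-\<^sup>k (d (p k) x - d x (p k)))\<close> is continuous and strictly increasing along the causal
  relation \<open>J\<close>; strictness is where points being distinguished by \<open>d\<close> enters
  (\<open>weighted_time_strict\<close>). As \<open>J\<close> is compact, causally related points at nearly equal times are
  near each other (\<open>causal_relation_quantitative\<close>). Hence a map \<open>\<sigma>\<close> from \<open>[\<tau> x, \<tau> y]\<close> to \<open>X\<close> that is
  increasing for \<open>J\<close> and satisfies \<open>\<tau> (\<sigma> s) = s\<close> is automatically a continuous isocausal curve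
  (\<open>near_curve_zero_isocausal\<close>). This replaces continuity, which a pointwise limit would not
  preserve, by conditions that are all of the form \<open>h \<sigma> \<le> 0\<close> with \<open>h\<close> depending continuously on
  finitely many values of \<open>\<sigma>\<close>. Additivity of \<open>d\<close> along \<open>\<sigma>\<close>, that is maximality, is of this form too.

  Third, such conditions can be solved exactly in a compact space as soon as they can be solved up to
  every \<open>e > 0\<close>. By Tychonoff's theorem the space of all maps from \<open>[\<tau> x, \<tau> y]\<close> to \<open>X\<close> is compact, so
  it suffices to find approximate solutions, which need not be continuous
  (\<open>near_curve_limit\<close>). They come from the curves in \<open>X\<^sub>n\<close>: transporting \<open>p\<close> by a
  correspondence of small distortion gives a continuous time function on \<open>X\<^sub>n\<close> that is close to \<open>\<tau>\<close>. By
  the intermediate value theorem a curve in \<open>X\<^sub>n\<close> can be parametrised by it, and the correspondence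
  carries the points of the curve back to \<open>X\<close> (\<open>near_curve_of_correspondence\<close>).
\<close>

section \<open>Approximate and exact solutions in compact spaces\<close>

text \<open>
  The sets of \<open>1/n\<close>-approximate solutions are closed, nonempty and nested.
\<close>
lemma compact_space_approximate_imp_exact:
  assumes P: "compact_space P"
    and H: "\<And>h. h \<in> H \<Longrightarrow> continuous_map P euclideanreal h"
    and approx: "\<And>e::real. e > 0 \<Longrightarrow> \<exists>f\<in>topspace P. \<forall>h\<in>H. h f \<le> e"
  shows "\<exists>f\<in>topspace P. \<forall>h\<in>H. h f \<le> 0"
proof -
  define C where "C n = \<Inter> (insert (topspace P) 
      ((\<lambda>h. {f \<in> topspace P. h f \<in> {.. inverse (real (Suc n))}}) ` H))" for n
  have mem: "f \<in> C n \<longleftrightarrow> f \<in> topspace P \<and> (\<forall>h\<in>H. h f \<le> inverse (real (Suc n)))" for f n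
    by (auto simp: C_def)
  have "(\<Inter>n. C n) \<noteq> {}"
  proof (rule compact_space_imp_nest[OF P])
    fix n
    show "closedin P (C n)"
      unfolding C_def
    proof (rule closedin_Inter)
      fix S assume "S \<in> insert (topspace P) ((\<lambda>h. {f \<in> topspace P. h f \<in> {.. inverse (real (Suc n))}}) ` H)"
      then show "closedin P S"
        by (auto simp del: atMost_iff intro!: closedin_continuous_map_preimage[OF H])
    qed auto
    show "C n \<noteq> {}"
      using approx[of "inverse (real (Suc n))"] mem by fastforce
  next
    show "decseq C"
      by (rule decseq_SucI) (fastforce simp: mem intro: order_trans)
  qed
  then obtain f where f: "\<And>n. f \<in> C n"
    by auto
  have "h f \<le> 0" if "h \<in> H" for h
  proof (rule field_le_epsilon)
    fix e :: real assume "e > 0"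
    then obtain n where "inverse (real (Suc n)) < e"
      using reals_Archimedean by blast
    then show "h f \<le> 0 + e"
      using f[of n] that unfolding mem by force
  qed
  with f show ?thesis
    unfolding mem by blast
qed

section \<open>The distinction metric\<close>

text \<open>
  The value \<open>0\<close> off the carrier makes the function nonnegative and symmetric on the whole ambient type,
  as \<^locale>\<open>Metric_space\<close> demands.
\<close>
definition distinction :: "'a set \<Rightarrow> ('a \<Rightarrow> 'a \<Rightarrow> real) \<Rightarrow> 'a \<Rightarrow> 'a \<Rightarrow> real" where
  "distinction X d x y =
     (if x \<in> X \<and> y \<in> X then SUP z\<in>X. max \<bar>d x z - d y z\<bar> \<bar>d z x - d z y\<bar> else 0)"

locale bounded_lorentzian =
  fixes X :: "'a set" and d :: "'a \<Rightarrow> 'a \<Rightarrow> real"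
  assumes bounded_lorentzian: "bounded_lorentzian_metric_space X d"
begin

lemma d_nonneg: "x \<in> X \<Longrightarrow> y \<in> X \<Longrightarrow> 0 \<le> d x y"
  using bounded_lorentzian unfolding bounded_lorentzian_metric_space_def by blast

lemma reverse_triangle:
  "x \<in> X \<Longrightarrow> y \<in> X \<Longrightarrow> z \<in> X \<Longrightarrow> 0 < d x y \<Longrightarrow> 0 < d y z \<Longrightarrow> d x y + d y z \<le> d x z"
  using bounded_lorentzian unfolding bounded_lorentzian_metric_space_def by blast

lemma distinguishing:
  "x \<in> X \<Longrightarrow> y \<in> X \<Longrightarrow> (\<And>z. z \<in> X \<Longrightarrow> d x z = d y z) \<Longrightarrow> (\<And>z. z \<in> X \<Longrightarrow> d z x = d z y)
    \<Longrightarrow> x = y"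
  using bounded_lorentzian unfolding bounded_lorentzian_metric_space_def by metis

lemma self_zero:
  assumes "x \<in> X" shows "d x x = 0"
  using d_nonneg[OF assms assms] reverse_triangle[OF assms assms assms] by linarith

text \<open>
  If \<open>d p x > 0\<close>, the reverse triangle inequality gives \<open>d p y \<ge> d p x + d x y\<close>; if \<open>d p x = 0\<close>,
  nonnegativity is enough.
\<close>
lemma chronological_imp_causal:
  assumes "x \<in> X" "y \<in> X" "0 < d x y"
  shows "(x, y) \<in> causal_relation X d"
proof -
  have "d p x \<le> d p y" "d y p \<le> d x p" if "p \<in> X" for p
    using that assms d_nonneg reverse_triangle by (smt (verit))+
  with assms show ?thesis
    by (auto simp: causal_relation_def)
qed

text \<open>
  On the compact set \<open>{d \<ge> 1}\<close> the continuous function \<open>d\<close> is bounded.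
\<close>
lemma bounded: obtains M where "\<And>x y. x \<in> X \<Longrightarrow> y \<in> X \<Longrightarrow> d x y \<le> M"
proof -
  obtain T where T: "lorentzian_admissible X d T"
    using bounded_lorentzian unfolding bounded_lorentzian_metric_space_def by blast
  let ?K = "{(p, q). p \<in> X \<and> q \<in> X \<and> d p q \<ge> 1}"
  have "compactin euclideanreal ((\<lambda>(p, q). d p q) ` ?K)"
    using T unfolding lorentzian_admissible_def
    by (intro image_compactin[of "prod_topology T T"]) auto
  then have "bdd_above ((\<lambda>(p, q). d p q) ` ?K)"
    by (simp only: compactin_euclidean_iff compact_imp_bounded bounded_imp_bdd_above)
  then obtain M where M: "\<And>v. v \<in> (\<lambda>(p, q). d p q) ` ?K \<Longrightarrow> v \<le> M"
    unfolding bdd_above_def by blast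
  show ?thesis
  proof (rule that)
    fix x y assume "x \<in> X" "y \<in> X"
    then show "d x y \<le> max M 1"
      using M[of "d x y"] by (cases "d x y \<ge> 1") force+
  qed
qed

text \<open>
  Boundedness of \<open>d\<close> makes the supremum genuine; all later reasoning about it goes through this
  characterisation.
\<close>
lemma distinction_le_iff:
  assumes "x \<in> X" "y \<in> X"
  shows "distinction X d x y \<le> e \<longleftrightarrow>
    (\<forall>z\<in>X. \<bar>d x z - d y z\<bar> \<le> e \<and> \<bar>d z x - d z y\<bar> \<le> e)"
proof -
  obtain M where M: "\<And>x y. x \<in> X \<Longrightarrow> y \<in> X \<Longrightarrow> d x y \<le> M"
    using bounded by blast
  have "bdd_above ((\<lambda>z. max \<bar>d x z - d y z\<bar> \<bar>d z x - d z y\<bar>) ` X)"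
  proof (rule bdd_aboveI2)
    fix z assume "z \<in> X"
    then show "max \<bar>d x z - d y z\<bar> \<bar>d z x - d z y\<bar> \<le> M"
      using assms M d_nonneg by (smt (verit, best))
  qed
  moreover have "X \<noteq> {}"
    using assms by blast
  ultimately show ?thesis
    unfolding distinction_def using assms by (simp add: cSUP_le_iff)
qed

lemma distinction_ge:
  assumes "x \<in> X" "y \<in> X" "z \<in> X"
  shows "\<bar>d x z - d y z\<bar> \<le> distinction X d x y" "\<bar>d z x - d z y\<bar> \<le> distinction X d x y"
  using distinction_le_iff[of x y "distinction X d x y"] assms by auto

sublocale Metric_space X "distinction X d"
proof
  show "0 \<le> distinction X d x y" for x y
    using distinction_ge(1)[of x y x] by (cases "x \<in> X \<and> y \<in> X") (force simp: distinction_def)+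
  show "distinction X d x y = distinction X d y x" for x y
    unfolding distinction_def by (simp add: abs_minus_commute)
  show "distinction X d x y = 0 \<longleftrightarrow> x = y" if "x \<in> X" "y \<in> X" for x y
  proof
    assume "distinction X d x y = 0"
    then show "x = y"
      using distinction_ge[OF that] by (intro distinguishing that) force+
  next
    assume "x = y"
    then show "distinction X d x y = 0"
      using distinction_le_iff[OF that, of 0] distinction_ge(1)[OF that that(1)] by force
  qed
  show "distinction X d x z \<le> distinction X d x y + distinction X d y z"
    if "x \<in> X" "y \<in> X" "z \<in> X" for x y z
    unfolding distinction_le_iff[OF that(1,3)]
    using that distinction_ge by (smt (verit, best))
qed

lemma continuous_map_d: "continuous_map (prod_topology mtopology mtopology) euclideanreal (\<lambda>(p, q). d p q)"
proof -
  have "continuous_map (prod_topology mtopology mtopology) Met_TC.mtopology (\<lambda>(p, q). d p q)"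
    unfolding Met_TC.continuous_map_to_metric
  proof (intro ballI allI impI)
    fix w :: "'a \<times> 'a" and e :: real
    assume w: "w \<in> topspace (prod_topology mtopology mtopology)" and e: "0 < e"
    obtain p q where pq: "w = (p, q)" "p \<in> X" "q \<in> X"
      using w by auto
    show "\<exists>U. openin (prod_topology mtopology mtopology) U \<and> w \<in> U \<and>
            (\<forall>y\<in>U. (case y of (p, q) \<Rightarrow> d p q) \<in> Met_TC.mball (case w of (p, q) \<Rightarrow> d p q) e)"
    proof (intro exI conjI ballI)
      show "openin (prod_topology mtopology mtopology) (mball p (e/2) \<times> mball q (e/2))"
        by (simp add: openin_prod_Times_iff)
      show "w \<in> mball p (e/2) \<times> mball q (e/2)"
        using pq e by simp
      fix w' assume "w' \<in> mball p (e/2) \<times> mball q (e/2)"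
      then obtain p' q' where w': "w' = (p', q')" "p' \<in> X" "q' \<in> X"
        "distinction X d p p' < e/2" "distinction X d q q' < e/2"
        by auto
      have "\<bar>d p q - d p' q'\<bar> < e"
        using distinction_ge(1)[of p p' q] distinction_ge(2)[of q q' p'] pq w' by linarith
      then show "(case w' of (p, q) \<Rightarrow> d p q) \<in> Met_TC.mball (case w of (p, q) \<Rightarrow> d p q) e"
        by (simp add: pq w' dist_real_def)
    qed
  qed
  then show ?thesis
    by simp
qed

text \<open>
  One half of the claim that every admissible topology is finer than the metric one. The
  \<open>z\<close> with \<open>d y z \<ge> e\<close> for some \<open>y\<close> form a compact set, over which continuity at \<open>(x, z)\<close> can be
  made uniform in \<open>z\<close>; for every other \<open>z\<close> both \<open>d x z\<close> and \<open>d y z\<close> lie in \<open>[0, e)\<close>, whatever \<open>y\<close> is.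
\<close>
lemma tube:
  assumes T: "lorentzian_admissible X d T" and "x \<in> X" "0 < e"
  shows "\<exists>U. openin T U \<and> x \<in> U \<and> (\<forall>y\<in>U. \<forall>z\<in>X. \<bar>d x z - d y z\<bar> \<le> e)"
proof -
  have top: "topspace T = X" 
    and cont: "continuous_map (prod_topology T T) euclideanreal (\<lambda>(p, q). d p q)"
    and comp: "compactin (prod_topology T T) {(p, q). p \<in> X \<and> q \<in> X \<and> d p q \<ge> e}"
    using T \<open>0 < e\<close> by (auto simp: lorentzian_admissible_def)
  define K where "K = snd ` {(p, q). p \<in> X \<and> q \<in> X \<and> d p q \<ge> e}"
  have K: "compactin T K"
    unfolding K_def by (rule image_compactin[OF comp continuous_map_snd])
  have "\<exists>U V. openin T U \<and> openin T V \<and> x \<in> U \<and> z \<in> V \<and> (\<forall>y\<in>U. \<forall>w\<in>V. \<bar>d y w - d x z\<bar> < e/2)"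
    if "z \<in> X" for z
  proof -
    let ?W = "{w \<in> topspace (prod_topology T T). (\<lambda>(p, q). d p q) w \<in> {d x z - e/2 <..< d x z + e/2}}"
    have "openin (prod_topology T T) ?W"
      using cont by (rule openin_continuous_map_preimage) auto
    moreover have "(x, z) \<in> ?W"
      using that assms top by auto
    ultimately obtain U V where UV: "openin T U" "openin T V" "x \<in> U" "z \<in> V" "U \<times> V \<subseteq> ?W"
      unfolding openin_prod_topology_alt by meson
    have "\<bar>d y w - d x z\<bar> < e/2" if "y \<in> U" "w \<in> V" for y w
    proof -
      have "(y, w) \<in> ?W"
        using UV(5) that by blast
      then have "d x z - e/2 < d y w" "d y w < d x z + e/2" by simp_all
      then show ?thesis by linarith
    qed
    with UV show ?thesis by blast
  qed
  then obtain U V where UV: "\<And>z. z \<in> X \<Longrightarrow> openin T (U z) \<and> openin T (V z) \<and> x \<in> U z \<and> z \<in> V z \<and>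
      (\<forall>y\<in>U z. \<forall>w\<in>V z. \<bar>d y w - d x z\<bar> < e/2)"
    by metis
  have KX: "K \<subseteq> X"
    by (auto simp: K_def)
  obtain F where F: "finite F" "F \<subseteq> K" "K \<subseteq> (\<Union>z\<in>F. V z)"
  proof -
    have "\<forall>W\<in>V ` K. openin T W" "K \<subseteq> \<Union>(V ` K)"
      using UV KX by blast+
    then obtain \<F> where "finite \<F>" "\<F> \<subseteq> V ` K" "K \<subseteq> \<Union>\<F>"
      using K unfolding compactin_def by meson
    then show ?thesis
      using that by (metis finite_subset_image)
  qed
  define W where "W = (\<Inter>z\<in>F. U z) \<inter> topspace T"
  have "openin T W"
    unfolding W_def using F KX UV by (intro openin_INT) blast+
  moreover have "x \<in> W"
    using F KX UV top \<open>x \<in> X\<close> by (auto simp: W_def)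
  moreover have "\<bar>d x z - d y z\<bar> \<le> e" if "y \<in> W" "z \<in> X" for y z
  proof (cases "z \<in> K")
    case True
    then obtain w where w: "w \<in> F" "z \<in> V w"
      using F by auto
    then have "w \<in> X" "y \<in> U w" "x \<in> U w"
      using F KX that UV by (auto simp: W_def)
    then have "\<bar>d y z - d x w\<bar> < e/2" "\<bar>d x z - d x w\<bar> < e/2"
      using UV w by blast+
    then show ?thesis by linarith
  next
    case False
    have "y \<in> X" using that top by (auto simp: W_def)
    with False that \<open>x \<in> X\<close> have "d x z < e" "d y z < e"
      by (force simp: K_def image_iff)+
    with d_nonneg[OF \<open>x \<in> X\<close> \<open>z \<in> X\<close>] d_nonneg[OF \<open>y \<in> X\<close> \<open>z \<in> X\<close>] show ?thesis
      by linarith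
  qed
  ultimately show ?thesis by blast
qed

end

text \<open>
  The axioms are invariant under time reversal. This yields the tube lemma for the second argument of
  \<open>d\<close> from that for the first.
\<close>
lemma continuous_map_swap_prod:
  "continuous_map (prod_topology T T) (prod_topology T T) prod.swap"
  unfolding prod.swap_def by (intro continuous_map_paired[THEN iffD2] conjI continuous_map_fst continuous_map_snd)

lemma lorentzian_admissible_converse:
  assumes "lorentzian_admissible X d T"
  shows "lorentzian_admissible X (\<lambda>x y. d y x) T"
proof -
  have "continuous_map (prod_topology T T) euclideanreal ((\<lambda>(p, q). d p q) \<circ> prod.swap)"
    using assms unfolding lorentzian_admissible_def
    by (intro continuous_map_compose[OF continuous_map_swap_prod]) auto
  moreover have "compactin (prod_topology T T) {(p, q). p \<in> X \<and> q \<in> X \<and> d q p \<ge> e}" if "e > 0" for e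
  proof -
    have "compactin (prod_topology T T) (prod.swap ` {(p, q). p \<in> X \<and> q \<in> X \<and> d p q \<ge> e})"
      using assms that unfolding lorentzian_admissible_def
      by (intro image_compactin[OF _ continuous_map_swap_prod]) auto
    also have "prod.swap ` {(p, q). p \<in> X \<and> q \<in> X \<and> d p q \<ge> e} = {(p, q). p \<in> X \<and> q \<in> X \<and> d q p \<ge> e}"
      by (auto simp: image_iff)
    finally show ?thesis .
  qed
  ultimately show ?thesis
    using assms unfolding lorentzian_admissible_def by (auto simp: o_def case_prod_unfold)
qed

lemma bounded_lorentzian_converse:
  assumes "bounded_lorentzian X d"
  shows "bounded_lorentzian X (\<lambda>x y. d y x)"
proof
  interpret bounded_lorentzian X d by fact
  show "bounded_lorentzian_metric_space X (\<lambda>x y. d y x)"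
    unfolding bounded_lorentzian_metric_space_def
  proof (intro conjI)
    show "\<exists>T. lorentzian_admissible X (\<lambda>x y. d y x) T"
      using bounded_lorentzian lorentzian_admissible_converse
      unfolding bounded_lorentzian_metric_space_def by blast
    show "\<forall>x\<in>X. \<forall>y\<in>X. \<forall>z\<in>X. 0 < d y x \<and> 0 < d z y \<longrightarrow> d y x + d z y \<le> d z x"
      by (metis add.commute reverse_triangle)
    show "\<forall>x\<in>X. \<forall>y\<in>X. x \<noteq> y \<longrightarrow> (\<exists>z\<in>X. d z x \<noteq> d z y \<or> d x z \<noteq> d y z)"
      using distinguishing by blast
  qed (use d_nonneg in auto)
qed

context bounded_lorentzian
begin

lemma admissible_continuous_map_id:
  assumes T: "lorentzian_admissible X d T"
  shows "continuous_map T mtopology id"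
  unfolding continuous_map_to_metric
proof (intro ballI allI impI)
  fix x and e :: real assume "x \<in> topspace T" "0 < e"
  then have x: "x \<in> X" and e: "0 < e/2"
    using T by (auto simp: lorentzian_admissible_def)
  obtain U where U: "openin T U" "x \<in> U" "\<And>y z. y \<in> U \<Longrightarrow> z \<in> X \<Longrightarrow> \<bar>d x z - d y z\<bar> \<le> e/2"
    using tube[OF T x e] by blast
  obtain V where V: "openin T V" "x \<in> V" "\<And>y z. y \<in> V \<Longrightarrow> z \<in> X \<Longrightarrow> \<bar>d z x - d z y\<bar> \<le> e/2"
    using bounded_lorentzian.tube[OF bounded_lorentzian_converse[OF bounded_lorentzian_axioms]
        lorentzian_admissible_converse[OF T] x e] by blast
  have "id y \<in> mball (id x) e" if y: "y \<in> U \<inter> V" for y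
  proof -
    have "y \<in> X"
      using y openin_subset[OF U(1)] T by (auto simp: lorentzian_admissible_def)
    moreover from this have "distinction X d x y \<le> e/2"
      using U(3) V(3) y x by (subst distinction_le_iff) auto
    ultimately show ?thesis
      using x e by simp
  qed
  then show "\<exists>U. openin T U \<and> x \<in> U \<and> (\<forall>y\<in>U. id y \<in> mball (id x) e)"
    using U V by (intro exI[of _ "U \<inter> V"]) auto
qed

text \<open>
  Compactness of \<open>{d \<ge> e}\<close> passes from any admissible topology to the coarser metric topology.
\<close>
lemma admissible_mtopology: "lorentzian_admissible X d mtopology"
proof -
  obtain T where T: "lorentzian_admissible X d T"
    using bounded_lorentzian unfolding bounded_lorentzian_metric_space_def by blast
  have id: "continuous_map (prod_topology T T) (prod_topology mtopology mtopology) (\<lambda>w. (id (fst w), id (snd w)))"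
    using continuous_map_compose[OF continuous_map_fst[of T T] admissible_continuous_map_id[OF T]]
      continuous_map_compose[OF continuous_map_snd[of T T] admissible_continuous_map_id[OF T]]
    by (simp only: continuous_map_paired o_def)
  have "compactin (prod_topology mtopology mtopology) {(p, q). p \<in> X \<and> q \<in> X \<and> d p q \<ge> e}" if "e > 0" for e
    using image_compactin[OF _ id, of "{(p, q). p \<in> X \<and> q \<in> X \<and> d p q \<ge> e}"] T that
    by (simp add: lorentzian_admissible_def)
  then show ?thesis
    by (simp add: lorentzian_admissible_def continuous_map_d)
qed

lemma lorentzian_topology_eq: "lorentzian_topology X d = mtopology"
proof (rule topology_eq[THEN iffD2], intro allI iffI)
  fix U assume "openin (lorentzian_topology X d) U"
  then show "openin mtopology U"
    using admissible_mtopology by (simp add: openin_lorentzian_topology)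
next
  fix U assume U: "openin mtopology U"
  show "openin (lorentzian_topology X d) U"
    unfolding openin_lorentzian_topology
  proof (intro conjI allI impI)
    show "U \<subseteq> X" using openin_subset[OF U] by simp
    fix T assume T: "lorentzian_admissible X d T"
    have "openin T {x \<in> topspace T. id x \<in> U}"
      using admissible_continuous_map_id[OF T] U by (rule openin_continuous_map_preimage)
    also have "{x \<in> topspace T. id x \<in> U} = U"
      using \<open>U \<subseteq> X\<close> T by (auto simp: lorentzian_admissible_def)
    finally show "openin T U" .
  qed
qed

text \<open>
  A cover needs one member around \<open>i\<^sup>0\<close>, which contains an \<open>e\<close>-ball. A point outside that ball is
  at distinction at least \<open>e\<close> from \<open>i\<^sup>0\<close>, so some value of \<open>d\<close> at it is at least \<open>e/2\<close>, and it lies in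
  one of the two projections of the compact set \<open>{d \<ge> e/2}\<close>.
\<close>
lemma compact_space_mtopology:
  assumes "contains_i0 X d"
  shows "compact_space mtopology"
proof -
  obtain i where i: "i \<in> X" "\<And>p. p \<in> X \<Longrightarrow> d i p = 0" "\<And>p. p \<in> X \<Longrightarrow> d p i = 0"
    using assms by (auto simp: contains_i0_def)
  have "\<exists>\<F>. finite \<F> \<and> \<F> \<subseteq> \<U> \<and> X \<subseteq> \<Union>\<F>"
    if \<U>: "\<And>U. U \<in> \<U> \<Longrightarrow> openin mtopology U" and cover: "X \<subseteq> \<Union>\<U>" for \<U>
  proof -
    obtain U where U: "U \<in> \<U>" "i \<in> U"
      using cover i by blast
    then obtain e where e: "e > 0" "mball i e \<subseteq> U"
      using \<U> by (meson openin_mtopology)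
    define K where "K = {(p, q). p \<in> X \<and> q \<in> X \<and> d p q \<ge> e/2}"
    have K: "compactin (prod_topology mtopology mtopology) K"
      using admissible_mtopology half_gt_zero[OF e(1)] unfolding K_def lorentzian_admissible_def by blast
    have "compactin mtopology (fst ` K \<union> snd ` K)"
      by (intro compactin_Un image_compactin[OF K] continuous_map_fst continuous_map_snd)
    moreover have "fst ` K \<union> snd ` K \<subseteq> X"
      by (auto simp: K_def)
    ultimately obtain \<F> where \<F>: "finite \<F>" "\<F> \<subseteq> \<U>" "fst ` K \<union> snd ` K \<subseteq> \<Union>\<F>"
      using \<U> subset_trans[OF _ cover] unfolding compactin_def by meson
    have "x \<in> \<Union>(insert U \<F>)" if x: "x \<in> X" for x
    proof (cases "x \<in> fst ` K \<union> snd ` K")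
      case False
      then have "d x z < e/2" "d z x < e/2" if "z \<in> X" for z
        using x that by (force simp: K_def image_iff)+
      then have "distinction X d i x \<le> e/2"
        unfolding distinction_le_iff[OF i(1) x]
        using x i d_nonneg by (simp add: less_imp_le)
      then have "x \<in> mball i e"
        using x i e by simp
      then show ?thesis using e by blast
    qed (use \<F> in blast)
    then show ?thesis
      using \<F> U by (intro exI[of _ "insert U \<F>"]) auto
  qed
  then show ?thesis
    by (auto simp: compact_space_def compactin_def)
qed

end

section \<open>Geometrically weighted sums\<close>
definition geometric_sum :: "(nat \<Rightarrow> real) \<Rightarrow> real" where
  "geometric_sum a = (\<Sum>k. (1/2) ^ k * a k)"

lemma summable_geometric_sum:
  assumes "\<And>k. \<bar>a k\<bar> \<le> M"
  shows "summable (\<lambda>k. (1/2) ^ k * a k :: real)"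
proof (rule summable_comparison_test')
  show "summable (\<lambda>k. (1/2::real) ^ k * M)"
    by (intro summable_mult2 summable_geometric) simp
  show "norm ((1/2) ^ k * a k) \<le> (1/2) ^ k * M" for k
    using assms[of k] by (simp add: abs_mult)
qed

lemma geometric_sum_diff_le:
  assumes "\<And>k. \<bar>a k\<bar> \<le> M" "\<And>k. \<bar>b k\<bar> \<le> M'" "\<And>k. \<bar>a k - b k\<bar> \<le> c"
  shows "\<bar>geometric_sum a - geometric_sum b\<bar> \<le> 2 * c"
proof -
  have "geometric_sum a - geometric_sum b = (\<Sum>k. (1/2) ^ k * (a k - b k))"
    unfolding geometric_sum_def
    by (simp add: suminf_diff summable_geometric_sum[OF assms(1)] summable_geometric_sum[OF assms(2)] right_diff_distrib)
  also have "\<bar>\<dots>\<bar> \<le> (\<Sum>k. (1/2) ^ k * c)"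
  proof -
    have "norm (\<Sum>k. (1/2) ^ k * (a k - b k)) \<le> (\<Sum>k. (1/2) ^ k * c)"
    proof (rule norm_suminf_le)
      show "norm ((1/2) ^ k * (a k - b k)) \<le> (1/2) ^ k * c" for k
        using assms(3)[of k] by (simp add: abs_mult)
      show "summable (\<lambda>k. (1/2::real) ^ k * c)"
        by (intro summable_mult2 summable_geometric) simp
    qed
    then show ?thesis by simp
  qed
  also have "\<dots> = 2 * c"
    using suminf_mult2[OF summable_geometric[of "1/2::real"], of c] suminf_geometric[of "1/2::real"] by simp
  finally show ?thesis .
qed

lemma geometric_sum_mono:
  assumes "\<And>k. \<bar>a k\<bar> \<le> M" "\<And>k. \<bar>b k\<bar> \<le> M'" "\<And>k. a k \<le> b k"
  shows "geometric_sum a \<le> geometric_sum b"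
  unfolding geometric_sum_def
  by (intro suminf_le mult_left_mono assms(3) summable_geometric_sum[OF assms(1)] summable_geometric_sum[OF assms(2)]) simp

text \<open>
  The differences \<open>b k - a k\<close> are nonnegative and their weighted sum, with positive weights, vanishes.
\<close>
lemma geometric_sum_strict:
  assumes "\<And>k. \<bar>a k\<bar> \<le> M" "\<And>k. \<bar>b k\<bar> \<le> M'" "\<And>k. a k \<le> b k"
    and "geometric_sum b \<le> geometric_sum a"
  shows "a k = b k"
proof -
  have "\<bar>b k - a k\<bar> \<le> M' + M" for k
    using assms(1)[of k] assms(2)[of k] by linarith
  then have s: "summable (\<lambda>k. (1/2) ^ k * (b k - a k))" 
    by (rule summable_geometric_sum)
  have nn: "0 \<le> (1/2) ^ k * (b k - a k)" for k
    using assms(3)[of k] by simp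
  have "(\<Sum>k. (1/2) ^ k * (b k - a k)) = geometric_sum b - geometric_sum a"
    unfolding geometric_sum_def
    by (simp add: suminf_diff summable_geometric_sum[OF assms(1)] summable_geometric_sum[OF assms(2)] right_diff_distrib)
  also have "\<dots> = 0"
    using geometric_sum_mono[of a M b M', OF assms(1-3)] assms(4) by simp
  finally have "(1/2) ^ k * (b k - a k) = 0"
    using suminf_eq_zero_iff[OF s nn] by blast
  then show ?thesis by simp
qed

lemma continuous_on_geometric_sum:
  assumes "\<And>t k. t \<in> S \<Longrightarrow> \<bar>a t k\<bar> \<le> M" "\<And>k. continuous_on S (\<lambda>t. a t k)"
  shows "continuous_on S (\<lambda>t. geometric_sum (a t))"
proof -
  have "uniform_limit S (\<lambda>n t. \<Sum>k<n. (1/2) ^ k * a t k) (\<lambda>t. \<Sum>k. (1/2) ^ k * a t k) sequentially"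
  proof (rule Weierstrass_m_test)
    show "norm ((1/2) ^ k * a t k) \<le> (1/2) ^ k * M" if "t \<in> S" for k t
      using assms(1)[OF that, of k] by (simp add: abs_mult)
    show "summable (\<lambda>k. (1/2::real) ^ k * M)"
      by (intro summable_mult2 summable_geometric) simp
  qed
  then show ?thesis
    unfolding geometric_sum_def
    by (rule uniform_limit_theorem[rotated]) (auto intro!: always_eventually continuous_intros assms(2))
qed

section \<open>A time function\<close>

text \<open>
  Each of \<open>d (p k)\<close> and \<open>- d _ (p k)\<close> is increasing along the causal relation. Keeping \<open>d\<close> and \<open>p\<close> as
  parameters allows comparing the time functions of two spaces with corresponding sequences.
\<close>
definition weighted_time :: "('a \<Rightarrow> 'a \<Rightarrow> real) \<Rightarrow> (nat \<Rightarrow> 'a) \<Rightarrow> 'a \<Rightarrow> real" where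
  "weighted_time d p x = geometric_sum (\<lambda>k. d (p k) x - d x (p k))"

context bounded_lorentzian
begin

lemma continuous_map_d_compose:
  assumes "continuous_map Q mtopology f" "continuous_map Q mtopology g"
  shows "continuous_map Q euclideanreal (\<lambda>w. d (f w) (g w))"
proof -
  have "continuous_map Q (prod_topology mtopology mtopology) (\<lambda>w. (f w, g w))"
    using assms by (simp add: continuous_map_paired)
  from continuous_map_compose[OF this continuous_map_d] show ?thesis
    by (simp add: o_def)
qed

lemma continuous_map_distinction:
  assumes "continuous_map Q mtopology f" "continuous_map Q mtopology g"
  shows "continuous_map Q euclideanreal (\<lambda>w. distinction X d (f w) (g w))"
  using continuous_map_mdist[of Q Self f g] assms by (simp add: mtopology_of_def)

lemma time_terms_bounded:
  obtains M where "\<And>z x. z \<in> X \<Longrightarrow> x \<in> X \<Longrightarrow> \<bar>d z x - d x z\<bar> \<le> M"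
proof -
  obtain M where M: "\<And>x y. x \<in> X \<Longrightarrow> y \<in> X \<Longrightarrow> d x y \<le> M"
    using bounded by blast
  have "\<bar>d z x - d x z\<bar> \<le> M" if "z \<in> X" "x \<in> X" for x z
    using M[OF that] M[OF that(2,1)] d_nonneg[OF that] d_nonneg[OF that(2,1)] by linarith
  with that show ?thesis by blast
qed

lemma weighted_time_mono:
  assumes "\<And>k. p k \<in> X" "(x, y) \<in> causal_relation X d"
  shows "weighted_time d p x \<le> weighted_time d p y"
proof -
  obtain M where M: "\<And>z x. z \<in> X \<Longrightarrow> x \<in> X \<Longrightarrow> \<bar>d z x - d x z\<bar> \<le> M"
    using time_terms_bounded by blast
  have "d (p k) x - d x (p k) \<le> d (p k) y - d y (p k)" for k
    using assms(2) assms(1)[of k] by (auto simp: causal_relation_def intro: diff_mono)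
  then show ?thesis
    unfolding weighted_time_def using assms M
    by (intro geometric_sum_mono[of _ M _ M]) (auto simp: causal_relation_def)
qed

lemma weighted_time_Lipschitz:
  assumes "\<And>k. p k \<in> X" "x \<in> X" "y \<in> X"
  shows "\<bar>weighted_time d p x - weighted_time d p y\<bar> \<le> 4 * distinction X d x y"
proof -
  obtain M where M: "\<And>z x. z \<in> X \<Longrightarrow> x \<in> X \<Longrightarrow> \<bar>d z x - d x z\<bar> \<le> M"
    using time_terms_bounded by blast
  have "\<bar>(d (p k) x - d x (p k)) - (d (p k) y - d y (p k))\<bar> \<le> 2 * distinction X d x y" for k
    using distinction_ge[OF assms(2,3) assms(1)[of k]] by linarith
  then have "\<bar>weighted_time d p x - weighted_time d p y\<bar> \<le> 2 * (2 * distinction X d x y)"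
    unfolding weighted_time_def using assms M
    by (intro geometric_sum_diff_le[of _ M _ M]) auto
  then show ?thesis by simp
qed

lemma continuous_map_weighted_time:
  assumes "\<And>k. p k \<in> X"
  shows "continuous_map mtopology euclideanreal (weighted_time d p)"
proof -
  have "continuous_map mtopology Met_TC.mtopology (weighted_time d p)"
    unfolding metric_continuous_map[OF Met_TC.Metric_space_axioms]
  proof (intro conjI ballI allI impI)
    fix x and e :: real assume "x \<in> X" "0 < e"
    then show "\<exists>r>0. \<forall>y. y \<in> X \<and> distinction X d x y < r \<longrightarrow> dist (weighted_time d p x) (weighted_time d p y) < e"
      using weighted_time_Lipschitz[of p, OF assms]
      by (intro exI[of _ "e/4"]) (fastforce simp: dist_real_def)
  qed simp
  then show ?thesis by simp
qed

definition mdense_sequence :: "(nat \<Rightarrow> 'a) \<Rightarrow> bool" where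
  "mdense_sequence p \<longleftrightarrow> (\<forall>k. p k \<in> X) \<and> (\<forall>x\<in>X. \<forall>e>0. \<exists>k. distinction X d x (p k) < e)"

text \<open>
  Equal times force \<open>d (p k) x = d (p k) y\<close> and \<open>d x (p k) = d y (p k)\<close> for all \<open>k\<close>. By density this
  holds with any point of \<open>X\<close> in place of \<open>p k\<close>, and \<open>d\<close> distinguishes points.
\<close>
lemma weighted_time_strict:
  assumes p: "mdense_sequence p" and xy: "(x, y) \<in> causal_relation X d"
    and le: "weighted_time d p y \<le> weighted_time d p x"
  shows "x = y"
proof -
  have X: "x \<in> X" "y \<in> X" "\<And>k. p k \<in> X"
    using xy p by (auto simp: causal_relation_def mdense_sequence_def)
  obtain M where M: "\<And>z x. z \<in> X \<Longrightarrow> x \<in> X \<Longrightarrow> \<bar>d z x - d x z\<bar> \<le> M"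
    using time_terms_bounded by blast
  have mono: "d (p k) x \<le> d (p k) y" "d y (p k) \<le> d x (p k)" for k
    using xy X by (auto simp: causal_relation_def)
  have "d (p k) x - d x (p k) = d (p k) y - d y (p k)" for k
  proof (rule geometric_sum_strict)
    show "\<bar>d (p k) x - d x (p k)\<bar> \<le> M" "\<bar>d (p k) y - d y (p k)\<bar> \<le> M" for k
      using M X by auto
    show "d (p k) x - d x (p k) \<le> d (p k) y - d y (p k)" for k
      using mono[of k] by linarith
    show "geometric_sum (\<lambda>k. d (p k) y - d y (p k)) \<le> geometric_sum (\<lambda>k. d (p k) x - d x (p k))"
      using le by (simp add: weighted_time_def)
  qed
  with mono have eq: "d (p k) x = d (p k) y" "d x (p k) = d y (p k)" for k
    by (smt (verit))+
  have "\<bar>d z x - d z y\<bar> \<le> 0 + e \<and> \<bar>d x z - d y z\<bar> \<le> 0 + e" if "z \<in> X" "e > 0" for z e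
  proof -
    obtain k where "distinction X d z (p k) < e/2"
      using p \<open>z \<in> X\<close> \<open>e > 0\<close> unfolding mdense_sequence_def by (meson half_gt_zero)
    with distinction_ge[OF \<open>z \<in> X\<close> X(3) X(1), of k] distinction_ge[OF \<open>z \<in> X\<close> X(3) X(2), of k] eq[of k]
    show ?thesis by linarith
  qed
  then have "\<bar>d z x - d z y\<bar> \<le> 0 \<and> \<bar>d x z - d y z\<bar> \<le> 0" if "z \<in> X" for z
    using that by (blast intro: field_le_epsilon)
  then show ?thesis
    using X by (intro distinguishing) auto
qed

text \<open>
  A modulus of continuity for the inverse of the time function, valid for all causal curves at once.
  Without it, the compactness of \<open>X \<times> X\<close> would give \<open>x\<close> and \<open>y\<close> with \<open>(x, y)\<close> causal,
  \<open>\<tau> y \<le> \<tau> x\<close> and distinction at least \<open>e\<close>, which strictness of \<open>\<tau>\<close> forbids.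
\<close>
lemma causal_relation_quantitative:
  assumes comp: "compact_space mtopology" and p: "mdense_sequence p" and e: "e > 0"
  obtains \<delta> where "\<delta> > 0" and "\<And>x y. (x, y) \<in> causal_relation X d \<Longrightarrow>
    weighted_time d p y - weighted_time d p x < \<delta> \<Longrightarrow> distinction X d x y < e"
proof -
  let ?\<tau> = "weighted_time d p"
  let ?P = "prod_topology mtopology mtopology"
  \<comment> \<open>On a pair \<open>w\<close>, the conditions \<open>h w \<le> 0\<close> say: causal, no time passes, distinction at least \<open>e\<close>.\<close>
  define H where "H = (\<lambda>z w. d z (fst w) - d z (snd w)) ` X \<union> (\<lambda>z w. d (snd w) z - d (fst w) z) ` X
     \<union> {\<lambda>w. ?\<tau> (snd w) - ?\<tau> (fst w), \<lambda>w. e - distinction X d (fst w) (snd w)}"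
  have \<tau>: "continuous_map mtopology euclideanreal ?\<tau>"
    using p by (intro continuous_map_weighted_time) (auto simp: mdense_sequence_def)
  have cont: "continuous_map ?P euclideanreal h" if "h \<in> H" for h
    using that \<tau> continuous_map_compose[OF continuous_map_fst \<tau>] continuous_map_compose[OF continuous_map_snd \<tau>]
    unfolding H_def
    by (auto simp: o_def intro!: continuous_map_diff continuous_map_d_compose continuous_map_fst
        continuous_map_snd continuous_map_distinction)
  have "\<exists>\<delta>>0. \<forall>x y. (x, y) \<in> causal_relation X d \<longrightarrow> ?\<tau> y - ?\<tau> x < \<delta> \<longrightarrow> distinction X d x y < e"
  proof (rule ccontr)
    assume neg: "\<not> ?thesis"
    have "\<exists>w\<in>topspace ?P. \<forall>h\<in>H. h w \<le> 0"
    proof (rule compact_space_approximate_imp_exact[OF _ cont])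
      show "compact_space ?P"
        using comp by (simp add: compact_space_prod_topology)
      fix r :: real assume "r > 0"
      then obtain x y where xy: "(x, y) \<in> causal_relation X d" "?\<tau> y - ?\<tau> x < r" "e \<le> distinction X d x y"
        using neg by (meson not_le)
      then have "h (x, y) \<le> r" if "h \<in> H" for h
        using that \<open>r > 0\<close> xy unfolding H_def causal_relation_def
        by (auto intro: order_trans[OF _ less_imp_le])
      moreover have "(x, y) \<in> topspace ?P"
        using xy by (simp add: causal_relation_def)
      ultimately show "\<exists>w\<in>topspace ?P. \<forall>h\<in>H. h w \<le> r"
        by blast
    qed
    then obtain x y where xy: "x \<in> X" "y \<in> X" "\<And>h. h \<in> H \<Longrightarrow> h (x, y) \<le> 0"
      by auto
    then have "d z x \<le> d z y" "d y z \<le> d x z" if "z \<in> X" for z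
      using xy(3)[of "\<lambda>w. d z (fst w) - d z (snd w)"] xy(3)[of "\<lambda>w. d (snd w) z - d (fst w) z"] that
      by (auto simp: H_def)
    then have "(x, y) \<in> causal_relation X d"
      using xy by (auto simp: causal_relation_def)
    moreover have "?\<tau> y \<le> ?\<tau> x" "e \<le> distinction X d x y"
      using xy(3)[of "\<lambda>w. ?\<tau> (snd w) - ?\<tau> (fst w)"] xy(3)[of "\<lambda>w. e - distinction X d (fst w) (snd w)"]
      by (auto simp: H_def)
    ultimately show False
      using weighted_time_strict[OF p] xy(1) e by fastforce
  qed
  with that show ?thesis by blast
qed

lemma ex_mdense_sequence:
  assumes comp: "compact_space mtopology" and "X \<noteq> {}"
  shows "\<exists>p. mdense_sequence p"
proof -
  have "mtotally_bounded X"
    using comp by (intro compactin_imp_mtotally_bounded) (simp add: compact_space_def)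
  then have "\<exists>K. finite K \<and> K \<subseteq> X \<and> X \<subseteq> (\<Union>x\<in>K. mball x (inverse (real (Suc n))))" for n
    unfolding mtotally_bounded_def by simp
  then obtain K where K: "\<And>n. finite (K n)" "\<And>n. K n \<subseteq> X" "\<And>n. X \<subseteq> (\<Union>x\<in>K n. mball x (inverse (real (Suc n))))"
    by metis
  define D where "D = (\<Union>n. K n)"
  have "countable D"
    unfolding D_def by (intro countable_UN countableI_type countable_finite K(1))
  moreover have "D \<noteq> {}" "D \<subseteq> X"
    using K(2) K(3)[of 0] \<open>X \<noteq> {}\<close> unfolding D_def by auto
  ultimately have D: "countable D" "D \<noteq> {}" "D \<subseteq> X" by auto
  have "mdense_sequence (from_nat_into D)"
    unfolding mdense_sequence_def
  proof (intro conjI allI ballI impI)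
    show "from_nat_into D k \<in> X" for k
      by (rule subsetD[OF D(3) from_nat_into[OF D(2)]])
    fix x and e :: real assume x: "x \<in> X" and "e > 0"
    then obtain n where n: "inverse (real (Suc n)) < e"
      using reals_Archimedean by blast
    obtain z where z: "z \<in> K n" "distinction X d z x < inverse (real (Suc n))"
      using K(3)[of n] x by auto
    then obtain k where "from_nat_into D k = z"
      using D from_nat_into_surj[OF D(1), of z] by (auto simp: D_def)
    then show "\<exists>k. distinction X d x (from_nat_into D k) < e"
      using z n commute by (metis order.strict_trans)
  qed
  then show ?thesis by blast
qed

end

section \<open>Limits of approximate causal curves\<close>

text \<open>
  A map that is an isocausal curve parametrised by \<open>\<tau>\<close>, and a maximal one if \<open>mx\<close> holds, up to an
  error \<open>e\<close> in every condition except for the endpoints. Continuity is absent on purpose: approximate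
  curves are images of curves under a correspondence and may jump, and for \<open>e = 0\<close> continuity follows
  from the other conditions.
\<close>
definition near_curve ::
    "'a set \<Rightarrow> ('a \<Rightarrow> 'a \<Rightarrow> real) \<Rightarrow> ('a \<Rightarrow> real) \<Rightarrow> bool \<Rightarrow> 'a \<Rightarrow> 'a \<Rightarrow> real \<Rightarrow> (real \<Rightarrow> 'a) \<Rightarrow> bool" where
  "near_curve X d \<tau> mx x y e f \<longleftrightarrow>
     f ` {\<tau> x..\<tau> y} \<subseteq> X \<and> f (\<tau> x) = x \<and> f (\<tau> y) = y \<and>
     (\<forall>s\<in>{\<tau> x..\<tau> y}. \<bar>\<tau> (f s) - s\<bar> \<le> e) \<and>
     (\<forall>s\<in>{\<tau> x..\<tau> y}. \<forall>t\<in>{\<tau> x..\<tau> y}. s \<le> t \<longrightarrow>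
        (\<forall>z\<in>X. d z (f s) \<le> d z (f t) + e \<and> d (f t) z \<le> d (f s) z + e)) \<and>
     (mx \<longrightarrow> (\<forall>s\<in>{\<tau> x..\<tau> y}. \<forall>t\<in>{\<tau> x..\<tau> y}. \<forall>u\<in>{\<tau> x..\<tau> y}. s < t \<and> t < u \<longrightarrow>
        \<bar>d (f s) (f t) + d (f t) (f u) - d (f s) (f u)\<bar> \<le> e))"

context bounded_lorentzian
begin

text \<open>
  Every condition in \<^const>\<open>near_curve\<close> bounds by \<open>e\<close> a function of at most three values of the map
  that is continuous for the topology of pointwise convergence, in which the maps into
  \<open>X\<close> form a compact space.
\<close>
lemma near_curve_limit:
  fixes p
  defines "\<tau> \<equiv> weighted_time d p"
  assumes comp: "compact_space mtopology" and p: "mdense_sequence p"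
    and xy: "x \<in> X" "y \<in> X" "\<tau> x < \<tau> y"
    and near: "\<And>e. e > 0 \<Longrightarrow> \<exists>f. near_curve X d \<tau> mx x y e f"
  shows "\<exists>\<sigma>. near_curve X d \<tau> mx x y 0 \<sigma>"
proof -
  let ?I = "{\<tau> x..\<tau> y}"
  let ?P = "product_topology (\<lambda>_. mtopology) ?I"
  define H :: "((real \<Rightarrow> 'a) \<Rightarrow> real) set" where
    "H = {\<lambda>f. distinction X d (f (\<tau> x)) x, \<lambda>f. distinction X d (f (\<tau> y)) y}
      \<union> {\<lambda>f. \<bar>\<tau> (f s) - s\<bar> | s. s \<in> ?I}
      \<union> {\<lambda>f. d z (f s) - d z (f t) | z s t. z \<in> X \<and> s \<in> ?I \<and> t \<in> ?I \<and> s \<le> t}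
      \<union> {\<lambda>f. d (f t) z - d (f s) z | z s t. z \<in> X \<and> s \<in> ?I \<and> t \<in> ?I \<and> s \<le> t}
      \<union> {\<lambda>f. \<bar>d (f s) (f t) + d (f t) (f u) - d (f s) (f u)\<bar> | s t u.
           mx \<and> s \<in> ?I \<and> t \<in> ?I \<and> u \<in> ?I \<and> s < t \<and> t < u}"
  have \<tau>: "continuous_map mtopology euclideanreal \<tau>"
    unfolding \<tau>_def using p by (intro continuous_map_weighted_time) (auto simp: mdense_sequence_def)
  have proj: "continuous_map ?P mtopology (\<lambda>f. f s)" if "s \<in> ?I" for s
    using that by (rule continuous_map_product_projection)
  have \<tau>_proj: "continuous_map ?P euclideanreal (\<lambda>f. \<tau> (f s))" if "s \<in> ?I" for s
    using continuous_map_compose[OF proj[OF that] \<tau>] by (simp add: o_def)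
  have const: "continuous_map ?P mtopology (\<lambda>f. z)" if "z \<in> X" for z
    using that by simp
  have ends: "\<tau> x \<in> ?I" "\<tau> y \<in> ?I"
    using xy by auto
  have cont: "continuous_map ?P euclideanreal h" if "h \<in> H" for h
    using that xy ends unfolding H_def
    by (auto intro!: continuous_map_distinction continuous_map_d_compose continuous_map_diff
        continuous_map_add continuous_map_real_abs proj \<tau>_proj const)
  have "\<exists>f\<in>topspace ?P. \<forall>h\<in>H. h f \<le> 0"
  proof (rule compact_space_approximate_imp_exact[OF _ cont])
    show "compact_space ?P"
      using comp by (simp add: compact_space_product_topology)
    fix e :: real assume "e > 0"
    then obtain f where f: "near_curve X d \<tau> mx x y e f"
      using near by blast
    \<comment> \<open>The points of the product space are the maps that are undefined outside the interval.\<close>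
    let ?g = "restrict f ?I"
    have "?g \<in> topspace ?P"
      using f by (auto simp: near_curve_def)
    moreover have "h ?g \<le> e" if "h \<in> H" for h
      using that f ends xy \<open>e > 0\<close> unfolding H_def near_curve_def
      by (auto simp: algebra_simps)
    ultimately show "\<exists>f\<in>topspace ?P. \<forall>h\<in>H. h f \<le> e"
      by blast
  qed
  then obtain \<sigma> where \<sigma>: "\<sigma> \<in> topspace ?P" "\<And>h. h \<in> H \<Longrightarrow> h \<sigma> \<le> 0"
    by blast
  have X: "\<sigma> s \<in> X" if "s \<in> ?I" for s
    using \<sigma>(1) that by auto
  have 1: "distinction X d (\<sigma> (\<tau> x)) x \<le> 0" "distinction X d (\<sigma> (\<tau> y)) y \<le> 0"
    using \<sigma>(2)[of "\<lambda>f. distinction X d (f (\<tau> x)) x"] \<sigma>(2)[of "\<lambda>f. distinction X d (f (\<tau> y)) y"]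
    unfolding H_def by blast+
  have 2: "\<bar>\<tau> (\<sigma> s) - s\<bar> \<le> 0" if "s \<in> ?I" for s
    by (rule \<sigma>(2)[of "\<lambda>f. \<bar>\<tau> (f s) - s\<bar>"]) (use that in \<open>unfold H_def, blast\<close>)
  have 3: "d z (\<sigma> s) - d z (\<sigma> t) \<le> 0" if "z \<in> X" "s \<in> ?I" "t \<in> ?I" "s \<le> t" for z s t
    by (rule \<sigma>(2)[of "\<lambda>f. d z (f s) - d z (f t)"]) (use that in \<open>unfold H_def, blast\<close>)
  have 4: "d (\<sigma> t) z - d (\<sigma> s) z \<le> 0" if "z \<in> X" "s \<in> ?I" "t \<in> ?I" "s \<le> t" for z s t
    by (rule \<sigma>(2)[of "\<lambda>f. d (f t) z - d (f s) z"]) (use that in \<open>unfold H_def, blast\<close>)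
  have 5: "\<bar>d (\<sigma> s) (\<sigma> t) + d (\<sigma> t) (\<sigma> u) - d (\<sigma> s) (\<sigma> u)\<bar> \<le> 0"
    if mx "s \<in> ?I" "t \<in> ?I" "u \<in> ?I" "s < t" "t < u" for s t u
    by (rule \<sigma>(2)[of "\<lambda>f. \<bar>d (f s) (f t) + d (f t) (f u) - d (f s) (f u)\<bar>"])
      (use that in \<open>unfold H_def, blast\<close>)
  have "\<sigma> (\<tau> x) = x" "\<sigma> (\<tau> y) = y"
    using 1 X[OF ends(1)] X[OF ends(2)] xy by (metis mdist_pos_less not_le)+
  moreover have "d z (\<sigma> s) \<le> d z (\<sigma> t) + 0 \<and> d (\<sigma> t) z \<le> d (\<sigma> s) z + 0"
    if "z \<in> X" "s \<in> ?I" "t \<in> ?I" "s \<le> t" for z s t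
    using 3[OF that] 4[OF that] by simp
  ultimately have "near_curve X d \<tau> mx x y 0 \<sigma>"
    unfolding near_curve_def using X 2 5 by blast
  then show ?thesis by blast
qed

text \<open>
  Since \<open>\<tau> (\<sigma> t) - \<tau> (\<sigma> s) = t - s\<close>, the modulus of \<open>causal_relation_quantitative\<close> is a modulus of
  continuity of \<open>\<sigma>\<close>, and \<open>\<sigma>\<close> is injective.
\<close>
lemma near_curve_zero_isocausal:
  fixes p
  defines "\<tau> \<equiv> weighted_time d p"
  assumes comp: "compact_space mtopology" and p: "mdense_sequence p"
    and xy: "\<tau> x < \<tau> y" and \<sigma>: "near_curve X d \<tau> mx x y 0 \<sigma>"
  shows "isocausal_curve X d (\<tau> x) (\<tau> y) \<sigma>" "mx \<Longrightarrow> maximal_isocausal_curve X d (\<tau> x) (\<tau> y) \<sigma>"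
proof -
  let ?I = "{\<tau> x..\<tau> y}"
  have X: "\<sigma> s \<in> X" and \<tau>\<sigma>: "\<tau> (\<sigma> s) = s" if "s \<in> ?I" for s
    using \<sigma> that by (auto simp: near_curve_def)
  have J: "(\<sigma> s, \<sigma> t) \<in> causal_relation X d" if "s \<in> ?I" "t \<in> ?I" "s \<le> t" for s t
    using \<sigma> that X unfolding near_curve_def causal_relation_def by simp
  have "continuous_map (top_of_set ?I) mtopology \<sigma>"
    unfolding continuous_map_to_metric
  proof (intro ballI allI impI)
    fix s and e :: real assume "s \<in> topspace (top_of_set ?I)" and e: "0 < e"
    then have s: "s \<in> ?I" by simp
    obtain \<delta> where \<delta>: "\<delta> > 0" "\<And>x y. (x, y) \<in> causal_relation X d \<Longrightarrow> \<tau> y - \<tau> x < \<delta> \<Longrightarrow> distinction X d x y < e"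
      using causal_relation_quantitative[OF comp p e] unfolding \<tau>_def by blast
    have "\<sigma> t \<in> mball (\<sigma> s) e" if t: "t \<in> ?I \<inter> ball s \<delta>" for t
    proof (cases "s \<le> t")
      case True
      then have "distinction X d (\<sigma> s) (\<sigma> t) < e"
        using s t by (intro \<delta>(2) J) (auto simp: \<tau>\<sigma> dist_real_def)
      then show ?thesis using X s t by simp
    next
      case False
      then have "distinction X d (\<sigma> t) (\<sigma> s) < e"
        using s t by (intro \<delta>(2) J) (auto simp: \<tau>\<sigma> dist_real_def)
      then show ?thesis using X s t by (simp add: commute)
    qed
    then show "\<exists>U. openin (top_of_set ?I) U \<and> s \<in> U \<and> (\<forall>t\<in>U. \<sigma> t \<in> mball (\<sigma> s) e)"
      using s \<delta>(1) by (intro exI[of _ "?I \<inter> ball s \<delta>"]) (auto simp: openin_open)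
  qed
  moreover have "\<sigma> s \<noteq> \<sigma> t" if "s \<in> ?I" "t \<in> ?I" "s < t" for s t
    using \<tau>\<sigma>[OF that(1)] \<tau>\<sigma>[OF that(2)] that(3) by auto
  ultimately show iso: "isocausal_curve X d (\<tau> x) (\<tau> y) \<sigma>"
    unfolding isocausal_curve_def lorentzian_topology_eq using xy J by auto
  show "maximal_isocausal_curve X d (\<tau> x) (\<tau> y) \<sigma>" if mx
    using iso that \<sigma> unfolding maximal_isocausal_curve_def near_curve_def by simp
qed

end

section \<open>Approximate curves from a correspondence\<close>

text \<open>
  A section of \<open>d\<close> is continuous for every admissible topology, hence for their intersection.
\<close>
lemma continuous_map_section:
  assumes z: "z \<in> X" and adm: "\<exists>T. lorentzian_admissible X d T"
  shows "continuous_map (lorentzian_topology X d) euclideanreal (\<lambda>q. d z q)"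
    "continuous_map (lorentzian_topology X d) euclideanreal (\<lambda>q. d q z)"
proof -
  have cont: "continuous_map T euclideanreal (\<lambda>q. d z q)" "continuous_map T euclideanreal (\<lambda>q. d q z)"
    and top: "topspace T = X"
    if T: "lorentzian_admissible X d T" for T
  proof -
    show top: "topspace T = X"
      using T by (simp add: lorentzian_admissible_def)
    have d: "continuous_map (prod_topology T T) euclideanreal (\<lambda>(p, q). d p q)"
      using T by (simp add: lorentzian_admissible_def)
    have "continuous_map T (prod_topology T T) (\<lambda>q. (z, q))" "continuous_map T (prod_topology T T) (\<lambda>q. (q, z))"
      using z top by (auto simp: continuous_map_paired)
    from this[THEN continuous_map_compose, OF d]
    show "continuous_map T euclideanreal (\<lambda>q. d z q)" "continuous_map T euclideanreal (\<lambda>q. d q z)"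
      by (simp_all add: o_def)
  qed
  show "continuous_map (lorentzian_topology X d) euclideanreal (\<lambda>q. d z q)"
    "continuous_map (lorentzian_topology X d) euclideanreal (\<lambda>q. d q z)"
    using cont top by (auto simp: continuous_map_def openin_lorentzian_topology)
qed

text \<open>
  Let \<open>q\<close> correspond to \<open>p\<close>. The two time functions differ by at most \<open>4 * e\<close> on corresponding points,
  since each term differs by at most \<open>2 * e\<close> and the weights sum to \<open>2\<close>. The time function of \<open>q\<close>
  along the curve is continuous, so for \<open>s\<close> in \<open>[\<tau> x, \<tau> y]\<close> some parameter \<open>\<theta> s\<close> has a time within \<open>4 * e\<close>
  of \<open>s\<close>. A point corresponding to \<open>\<sigma> (\<theta> s)\<close> serves as \<open>f s\<close>, with a time error of at most \<open>8 * e\<close>. Causal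
  order and additivity of \<open>d\<close> hold exactly for the points \<open>\<sigma> (\<theta> s)\<close> because \<open>\<theta>\<close> is increasing.
\<close>
lemma near_curve_of_correspondence:
  fixes Y :: "'a set" and X :: "'b set"
  assumes Y: "bounded_lorentzian_metric_space Y dY" and X: "bounded_lorentzian_metric_space X d"
    and R: "correspondence Y X R" and e: "0 < e"
    and dis: "\<And>c c' z z'. (c, z) \<in> R \<Longrightarrow> (c', z') \<in> R \<Longrightarrow> \<bar>dY c c' - d z z'\<bar> \<le> e"
    and p: "\<And>k. p k \<in> X"
    and \<sigma>: "isocausal_curve Y dY \<alpha> \<beta> \<sigma>" "mx \<Longrightarrow> maximal_isocausal_curve Y dY \<alpha> \<beta> \<sigma>"
    and ends: "(\<sigma> \<alpha>, x) \<in> R" "(\<sigma> \<beta>, y) \<in> R"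
    and xy: "weighted_time d p x < weighted_time d p y"
  shows "\<exists>f. near_curve X d (weighted_time d p) mx x y (8 * e) f"
proof -
  interpret Y: bounded_lorentzian Y dY by (rule bounded_lorentzian.intro[OF Y])
  interpret X: bounded_lorentzian X d by (rule bounded_lorentzian.intro[OF X])
  have RY: "c \<in> Y" and RX: "z \<in> X" if "(c, z) \<in> R" for c z
    using R that by (auto simp: correspondence_def)
  have "\<forall>k. \<exists>c. (c, p k) \<in> R"
    using R p unfolding correspondence_def by blast
  then obtain q where q: "\<And>k. (q k, p k) \<in> R"
    by metis
  obtain M where M: "\<And>z x. z \<in> Y \<Longrightarrow> x \<in> Y \<Longrightarrow> \<bar>dY z x - dY x z\<bar> \<le> M"
    using Y.time_terms_bounded by blast
  obtain M' where M': "\<And>z x. z \<in> X \<Longrightarrow> x \<in> X \<Longrightarrow> \<bar>d z x - d x z\<bar> \<le> M'"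
    using X.time_terms_bounded by blast
  let ?\<tau> = "weighted_time d p" and ?\<tau>Y = "weighted_time dY q"
  have \<tau>_close: "\<bar>?\<tau>Y c - ?\<tau> z\<bar> \<le> 4 * e" if "(c, z) \<in> R" for c z
  proof -
    have "\<bar>(dY (q k) c - dY c (q k)) - (d (p k) z - d z (p k))\<bar> \<le> 2 * e" for k
      using dis[OF q[of k] that] dis[OF that q[of k]] by linarith
    then have "\<bar>?\<tau>Y c - ?\<tau> z\<bar> \<le> 2 * (2 * e)"
      unfolding weighted_time_def
      by (rule geometric_sum_diff_le[OF M[OF RY[OF q] RY[OF that]] M'[OF RX[OF q] RX[OF that]]])
    then show ?thesis by simp
  qed
  have "\<alpha> < \<beta>" and \<sigma>_cont: "continuous_map (top_of_set {\<alpha>..\<beta>}) (lorentzian_topology Y dY) \<sigma>"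
    and \<sigma>_J: "\<And>s t. s \<in> {\<alpha>..\<beta>} \<Longrightarrow> t \<in> {\<alpha>..\<beta>} \<Longrightarrow> s < t \<Longrightarrow> (\<sigma> s, \<sigma> t) \<in> causal_relation Y dY"
    using \<sigma>(1) by (auto simp: isocausal_curve_def)
  have \<sigma>Y: "\<sigma> s \<in> Y" if "s \<in> {\<alpha>..\<beta>}" for s
    using continuous_map_image_subset_topspace[OF \<sigma>_cont] that by auto
  have \<sigma>_J': "(\<sigma> s, \<sigma> t) \<in> causal_relation Y dY" if "s \<in> {\<alpha>..\<beta>}" "t \<in> {\<alpha>..\<beta>}" "s \<le> t" for s t
    using \<sigma>_J[OF that(1,2)] that \<sigma>Y by (cases "s = t") (auto simp: causal_relation_def)
  define u where "u t = ?\<tau>Y (\<sigma> t)" for t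
  have u_mono: "u s \<le> u t" if "s \<in> {\<alpha>..\<beta>}" "t \<in> {\<alpha>..\<beta>}" "s \<le> t" for s t
    unfolding u_def by (rule Y.weighted_time_mono[OF RY[OF q] \<sigma>_J'[OF that]])
  have u_cont: "continuous_on {\<alpha>..\<beta>} u"
    unfolding u_def weighted_time_def
  proof (rule continuous_on_geometric_sum)
    show "\<bar>dY (q k) (\<sigma> t) - dY (\<sigma> t) (q k)\<bar> \<le> M" if "t \<in> {\<alpha>..\<beta>}" for t k
      using M \<sigma>Y[OF that] RY[OF q] by blast
    have "\<exists>T. lorentzian_admissible Y dY T"
      using Y by (simp add: bounded_lorentzian_metric_space_def)
    note sec = continuous_map_section[OF RY[OF q] this]
    have "continuous_on {\<alpha>..\<beta>} (\<lambda>t. dY (q k) (\<sigma> t))" "continuous_on {\<alpha>..\<beta>} (\<lambda>t. dY (\<sigma> t) (q k))" for k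
      using continuous_map_compose[OF \<sigma>_cont sec(1)[of k]] continuous_map_compose[OF \<sigma>_cont sec(2)[of k]]
      by (simp_all add: o_def)
    then show "continuous_on {\<alpha>..\<beta>} (\<lambda>t. dY (q k) (\<sigma> t) - dY (\<sigma> t) (q k))" for k
      by (intro continuous_on_diff)
  qed
  have u_ends: "\<bar>u \<alpha> - ?\<tau> x\<bar> \<le> 4 * e" "\<bar>u \<beta> - ?\<tau> y\<bar> \<le> 4 * e"
    using \<tau>_close ends by (auto simp: u_def)
  have u_le: "u \<alpha> \<le> u \<beta>"
    using \<open>\<alpha> < \<beta>\<close> by (intro u_mono) auto
  have "\<exists>t\<in>{\<alpha>..\<beta>}. u t = v" if "u \<alpha> \<le> v" "v \<le> u \<beta>" for v
    using IVT'[of u \<alpha> v \<beta>] that \<open>\<alpha> < \<beta>\<close> u_cont by auto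
  then obtain h where h: "\<And>v. u \<alpha> \<le> v \<Longrightarrow> v \<le> u \<beta> \<Longrightarrow> h v \<in> {\<alpha>..\<beta>} \<and> u (h v) = v"
    by metis
  \<comment> \<open>The curve covers the times from \<open>u \<alpha>\<close> to \<open>u \<beta>\<close> only, which may fall short of \<open>\<tau> x\<close> and \<open>\<tau> y\<close>.
    Setting \<open>\<theta>\<close> by hand at the two ends makes \<open>f\<close> attain \<open>x\<close> and \<open>y\<close> exactly. The
    map \<open>\<theta>\<close> is increasing because \<open>u\<close> is and because equal clamped times get the same parameter.\<close>
  define clamp where "clamp s = max (u \<alpha>) (min (u \<beta>) s)" for s
  define \<theta> where "\<theta> s = (if s = ?\<tau> x then \<alpha> else if s = ?\<tau> y then \<beta> else h (clamp s))" for s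
  have clamp: "u \<alpha> \<le> clamp s" "clamp s \<le> u \<beta>" for s
    using u_le by (auto simp: clamp_def)
  have \<theta>: "\<theta> s \<in> {\<alpha>..\<beta>}" for s
    using h[OF clamp, of s] \<open>\<alpha> < \<beta>\<close> by (auto simp: \<theta>_def)
  have \<theta>_mono: "\<theta> s \<le> \<theta> t" if "s \<in> {?\<tau> x..?\<tau> y}" "t \<in> {?\<tau> x..?\<tau> y}" "s \<le> t" for s t
  proof (cases "s = ?\<tau> x \<or> t = ?\<tau> y \<or> t = ?\<tau> x \<or> s = ?\<tau> y \<or> clamp s = clamp t")
    case True
    then show ?thesis
      using that \<theta>[of s] \<theta>[of t] xy by (auto simp: \<theta>_def)
  next
    case False
    then have "\<theta> s = h (clamp s)" "\<theta> t = h (clamp t)" "clamp s < clamp t"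
      using that by (auto simp: \<theta>_def clamp_def)
    then have "u (\<theta> s) < u (\<theta> t)"
      using h[OF clamp] by simp
    then show ?thesis
      using u_mono[of "\<theta> t" "\<theta> s"] \<theta> by fastforce
  qed
  define g where "g t = (if t = \<alpha> then x else if t = \<beta> then y else (SOME z. (\<sigma> t, z) \<in> R))" for t
  have g: "(\<sigma> t, g t) \<in> R" if "t \<in> {\<alpha>..\<beta>}" for t
  proof -
    have "\<exists>z. (\<sigma> t, z) \<in> R"
      using R \<sigma>Y[OF that] by (auto simp: correspondence_def)
    then have "(\<sigma> t, SOME z. (\<sigma> t, z) \<in> R) \<in> R"
      by (rule someI_ex)
    then show ?thesis
      using ends by (auto simp: g_def)
  qed
  define f where "f s = g (\<theta> s)" for s
  have f: "(\<sigma> (\<theta> s), f s) \<in> R" for s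
    unfolding f_def by (rule g[OF \<theta>])
  have f_ends: "f (?\<tau> x) = x" "f (?\<tau> y) = y"
    using \<open>\<alpha> < \<beta>\<close> xy by (auto simp: f_def g_def \<theta>_def)
  have "near_curve X d ?\<tau> mx x y (8 * e) f"
    unfolding near_curve_def
  proof (intro conjI ballI impI)
    show "f ` {?\<tau> x..?\<tau> y} \<subseteq> X"
      using RX[OF f] by blast
    show "f (?\<tau> x) = x" "f (?\<tau> y) = y" by (fact f_ends)+
  next
    fix s assume s: "s \<in> {?\<tau> x..?\<tau> y}"
    show "\<bar>?\<tau> (f s) - s\<bar> \<le> 8 * e"
    proof (cases "s = ?\<tau> x \<or> s = ?\<tau> y")
      case True
      then show ?thesis using f_ends e by auto
    next
      case False
      then have "u (\<theta> s) = clamp s"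
        using h[OF clamp] by (simp add: \<theta>_def)
      then have "\<bar>clamp s - ?\<tau> (f s)\<bar> \<le> 4 * e"
        using \<tau>_close[OF f, of s] by (simp add: u_def)
      moreover have "\<bar>clamp s - s\<bar> \<le> 4 * e"
        using s u_ends u_le e by (auto simp: clamp_def max_def min_def)
      ultimately show ?thesis by linarith
    qed
  next
    fix s t z assume st: "s \<in> {?\<tau> x..?\<tau> y}" "t \<in> {?\<tau> x..?\<tau> y}" "s \<le> t" and z: "z \<in> X"
    obtain c where c: "(c, z) \<in> R"
      using R z by (auto simp: correspondence_def)
    have J: "dY c (\<sigma> (\<theta> s)) \<le> dY c (\<sigma> (\<theta> t))" "dY (\<sigma> (\<theta> t)) c \<le> dY (\<sigma> (\<theta> s)) c"
      using \<sigma>_J'[OF \<theta> \<theta> \<theta>_mono[OF st]] RY[OF c] by (auto simp: causal_relation_def)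
    show "d z (f s) \<le> d z (f t) + 8 * e"
      using dis[OF c f[of s]] dis[OF c f[of t]] J(1) e by linarith
    show "d (f t) z \<le> d (f s) z + 8 * e"
      using dis[OF f[of s] c] dis[OF f[of t] c] J(2) e by linarith
  next
    fix s t v assume mx and I: "s \<in> {?\<tau> x..?\<tau> y}" "t \<in> {?\<tau> x..?\<tau> y}" "v \<in> {?\<tau> x..?\<tau> y}" and lt: "s < t \<and> t < v"
    let ?s = "\<sigma> (\<theta> s)" and ?t = "\<sigma> (\<theta> t)" and ?v = "\<sigma> (\<theta> v)"
    have le: "\<theta> s \<le> \<theta> t" "\<theta> t \<le> \<theta> v"
      using \<theta>_mono I lt by auto
    have "dY ?s ?t + dY ?t ?v = dY ?s ?v"
    proof (cases "\<theta> s = \<theta> t \<or> \<theta> t = \<theta> v")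
      case True
      then show ?thesis
        using Y.self_zero[OF \<sigma>Y[OF \<theta>]] by auto
    next
      case False
      with le have "\<theta> s < \<theta> t" "\<theta> t < \<theta> v" by auto
      then show ?thesis
        using \<sigma>(2)[OF \<open>mx\<close>] \<theta> unfolding maximal_isocausal_curve_def by blast
    qed
    then show "\<bar>d (f s) (f t) + d (f t) (f v) - d (f s) (f v)\<bar> \<le> 8 * e"
      using dis[OF f[of s] f[of t]] dis[OF f[of t] f[of v]] dis[OF f[of s] f[of v]] e by linarith
  qed
  then show ?thesis by blast
qed

section \<open>Length and prelength spaces under Gromov-Hausdorff convergence\<close>
lemma gromov_hausdorff_dist_less_imp:
  assumes "gromov_hausdorff_dist X dX Y dY < ennreal e"
  obtains R where "correspondence X Y R"
    and "\<And>x y x' y'. (x, y) \<in> R \<Longrightarrow> (x', y') \<in> R \<Longrightarrow> \<bar>dX x x' - dY y y'\<bar> < e"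
proof -
  obtain R where R: "correspondence X Y R" "distortion dX dY R < ennreal e"
    using assms unfolding gromov_hausdorff_dist_def Inf_less_iff by blast
  have "\<bar>dX x x' - dY y y'\<bar> < e" if "(x, y) \<in> R" "(x', y') \<in> R" for x y x' y'
  proof -
    have "ennreal \<bar>dX x x' - dY y y'\<bar> \<le> distortion dX dY R"
      unfolding distortion_def using that by (intro Sup_upper) blast
    with R(2) have "ennreal \<bar>dX x x' - dY y y'\<bar> < ennreal e" by (rule le_less_trans[rotated])
    then show ?thesis
      by (simp add: ennreal_less_iff)
  qed
  with R that show ?thesis by blast
qed

text \<open>
  The flag \<open>mx\<close> selects between maximal and arbitrary isocausal curves, so that the two cases share one
  proof.
\<close>
lemma gromov_hausdorff_limit_curve:
  assumes conv: "(\<lambda>n. gromov_hausdorff_dist (Xn n) (dn n) X d) \<longlonglongrightarrow> 0"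
    and X: "bounded_lorentzian_metric_space X d" "contains_i0 X d"
    and Xn: "\<And>n. bounded_lorentzian_metric_space (Xn n) (dn n)"
    and curves: "\<And>n c c'. c \<in> Xn n \<Longrightarrow> c' \<in> Xn n \<Longrightarrow> 0 < dn n c c' \<Longrightarrow>
      \<exists>a b \<sigma>. isocausal_curve (Xn n) (dn n) a b \<sigma> \<and>
        (mx \<longrightarrow> maximal_isocausal_curve (Xn n) (dn n) a b \<sigma>) \<and> \<sigma> a = c \<and> \<sigma> b = c'"
    and xy: "x \<in> X" "y \<in> X" "0 < d x y"
  shows "\<exists>a b \<sigma>. isocausal_curve X d a b \<sigma> \<and> (mx \<longrightarrow> maximal_isocausal_curve X d a b \<sigma>) \<and>
    \<sigma> a = x \<and> \<sigma> b = y"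
proof -
  interpret bounded_lorentzian X d by (rule bounded_lorentzian.intro[OF X(1)])
  have comp: "compact_space mtopology"
    using X(2) by (rule compact_space_mtopology)
  obtain p where p: "mdense_sequence p"
    using ex_mdense_sequence[OF comp] xy by blast
  then have pX: "\<And>k. p k \<in> X"
    by (simp add: mdense_sequence_def)
  let ?\<tau> = "weighted_time d p"
  have less: "?\<tau> x < ?\<tau> y"
    using weighted_time_strict[OF p chronological_imp_causal[OF xy]] self_zero[OF xy(1)] xy(3) by fastforce
  have "\<exists>f. near_curve X d ?\<tau> mx x y e f" if "e > 0" for e
  proof -
    \<comment> \<open>A distortion below \<open>d x y\<close> keeps points corresponding to \<open>x\<close> and \<open>y\<close> chronologically related; the
      factor \<open>8\<close> is the loss in \<open>near_curve_of_correspondence\<close>.\<close>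
    define r where "r = min (e/8) (d x y)"
    have r: "0 < r" "r \<le> d x y" "8 * r \<le> e"
      using that xy by (auto simp: r_def)
    have "0 < ennreal r" using r by simp
    then have "\<forall>\<^sub>F n in sequentially. gromov_hausdorff_dist (Xn n) (dn n) X d < ennreal r"
      by (rule order_tendstoD(2)[OF conv])
    then obtain n where n: "gromov_hausdorff_dist (Xn n) (dn n) X d < ennreal r"
      by (auto simp: eventually_sequentially)
    obtain R where R: "correspondence (Xn n) X R"
      "\<And>c z c' z'. (c, z) \<in> R \<Longrightarrow> (c', z') \<in> R \<Longrightarrow> \<bar>dn n c c' - d z z'\<bar> < r"
      using gromov_hausdorff_dist_less_imp[OF n] by metis
    obtain c c' where c: "c \<in> Xn n" "c' \<in> Xn n" "(c, x) \<in> R" "(c', y) \<in> R"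
      using R(1) xy unfolding correspondence_def by meson
    have "0 < dn n c c'"
      using R(2)[OF c(3,4)] r by linarith
    then obtain a b \<sigma> where \<sigma>: "isocausal_curve (Xn n) (dn n) a b \<sigma>"
      "mx \<longrightarrow> maximal_isocausal_curve (Xn n) (dn n) a b \<sigma>" "\<sigma> a = c" "\<sigma> b = c'"
      using curves c by meson
    have "\<exists>f. near_curve X d ?\<tau> mx x y (8 * r) f"
    proof (rule near_curve_of_correspondence[OF Xn X(1) R(1) r(1) _ pX \<sigma>(1) _ _ _ less])
      show "\<bar>dn n c c' - d z z'\<bar> \<le> r" if "(c, z) \<in> R" "(c', z') \<in> R" for c c' z z'
        using R(2)[OF that] by simp
    qed (use \<sigma> c in auto)
    then obtain f where "near_curve X d ?\<tau> mx x y (8 * r) f" ..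
    then have "near_curve X d ?\<tau> mx x y e f"
      using r(3) unfolding near_curve_def by (meson add_left_mono order_trans)
    then show ?thesis by blast
  qed
  then obtain \<sigma> where \<sigma>: "near_curve X d ?\<tau> mx x y 0 \<sigma>"
    using near_curve_limit[OF comp p xy(1,2) less] by blast
  then have "\<sigma> (?\<tau> x) = x" "\<sigma> (?\<tau> y) = y"
    by (auto simp: near_curve_def)
  with near_curve_zero_isocausal[OF comp p less \<sigma>] show ?thesis
    by blast
qed

theorem theorem5p18:
  fixes Xn :: "nat \<Rightarrow> 'a set" and dn :: "nat \<Rightarrow> 'a \<Rightarrow> 'a \<Rightarrow> real"
    and X :: "'b set" and d :: "'b \<Rightarrow> 'b \<Rightarrow> real"
  assumes "\<And>n. contains_i0 (Xn n) (dn n)"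
    and "bounded_lorentzian_metric_space X d"
    and "contains_i0 X d"
    and "(\<lambda>n. gromov_hausdorff_dist (Xn n) (dn n) X d) \<longlonglongrightarrow> 0"
  shows "((\<forall>n. bounded_lorentzian_length_space (Xn n) (dn n)) \<longrightarrow>
            bounded_lorentzian_length_space X d) \<and>
         ((\<forall>n. bounded_lorentzian_prelength_space (Xn n) (dn n)) \<longrightarrow>
            bounded_lorentzian_prelength_space X d)"
proof (intro conjI impI)
  assume len: "\<forall>n. bounded_lorentzian_length_space (Xn n) (dn n)"
  have "\<exists>a b \<sigma>. isocausal_curve X d a b \<sigma> \<and> (True \<longrightarrow> maximal_isocausal_curve X d a b \<sigma>) \<and>
      \<sigma> a = x \<and> \<sigma> b = y" if "x \<in> X" "y \<in> X" "0 < d x y" for x y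
  proof (rule gromov_hausdorff_limit_curve[OF assms(4,2,3) _ _ that])
    show "bounded_lorentzian_metric_space (Xn n) (dn n)" for n
      using len by (simp add: bounded_lorentzian_length_space_def)
    show "\<exists>a b \<sigma>. isocausal_curve (Xn n) (dn n) a b \<sigma> \<and>
        (True \<longrightarrow> maximal_isocausal_curve (Xn n) (dn n) a b \<sigma>) \<and> \<sigma> a = c \<and> \<sigma> b = c'"
      if "c \<in> Xn n" "c' \<in> Xn n" "0 < dn n c c'" for n c c'
      using len that unfolding bounded_lorentzian_length_space_def maximal_isocausal_curve_def by meson
  qed
  with assms(2) show "bounded_lorentzian_length_space X d"
    unfolding bounded_lorentzian_length_space_def by meson
next
  assume len: "\<forall>n. bounded_lorentzian_prelength_space (Xn n) (dn n)"
  have "\<exists>a b \<sigma>. isocausal_curve X d a b \<sigma> \<and> (False \<longrightarrow> maximal_isocausal_curve X d a b \<sigma>) \<and>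
      \<sigma> a = x \<and> \<sigma> b = y" if "x \<in> X" "y \<in> X" "0 < d x y" for x y
  proof (rule gromov_hausdorff_limit_curve[OF assms(4,2,3) _ _ that])
    show "bounded_lorentzian_metric_space (Xn n) (dn n)" for n
      using len by (simp add: bounded_lorentzian_prelength_space_def)
    show "\<exists>a b \<sigma>. isocausal_curve (Xn n) (dn n) a b \<sigma> \<and>
        (False \<longrightarrow> maximal_isocausal_curve (Xn n) (dn n) a b \<sigma>) \<and> \<sigma> a = c \<and> \<sigma> b = c'"
      if "c \<in> Xn n" "c' \<in> Xn n" "0 < dn n c c'" for n c c'
      using len that unfolding bounded_lorentzian_prelength_space_def by meson
  qed
  with assms(2) show "bounded_lorentzian_prelength_space X d"
    unfolding bounded_lorentzian_prelength_space_def by meson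
qed

end
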